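(* For the system of total differential equations (T) to have at least one $(s_1,s_2)$-nonautonomous $(n-k_1,n-k_2)$-cylindricality $\mathbb R$-differentiable first integral $F\colon(z,w)\mapsto F({}^sz,{}^kw)$ on $G'$ (of the form described in the context), it is necessary and sufficient that there exist vector functions ${}^{s_1}\psi({}^sz,{}^kw)$, ${}^{s_2}\psi({}^sz,{}^kw)$, ${}^\lambda\varphi({}^sz,{}^kw)$ satisfying the functional system (E$_0$) and such that the function $F$ is a general integral of the Pfaffian differential equation (P).
   Context: Setting. $G\subset\mathbb C^{m+n}$ is a domain with points $(z,w)$, $z=(z_1,\dots,z_m)$, $w=(w_1,\dots,w_n)$, and $G'\subset G$ is a subdomain. $\mathbb R$-differentiable means differentiable as a function of the real and imaginary parts of the variables (all higher derivatives that appear are assumed to exist); $\partial_{z_j},\partial_{\overline z_j},\partial_{w_\xi},\partial_{\overline w_\xi}$ are Wirtinger derivatives; bars over functions denote complex conjugation. System (T) is $$dw_\xi=\sum_{j=1}^m\bigl(X_{\xi j}(z,w)\,dz_j+X_{\xi,m+j}(z,w)\,d\overline z_j\bigr),\quad \xi=1,\dots,n,\tag{T}$$ with $\mathbb R$-differentiable $X_{\xi l}\colon G\to\mathbb C$. Put, for $j=1,\dots,m$, $\mathfrak X_j=\partial_{z_j}+\sum_{\xi=1}^n(X_{\xi j}\partial_{w_\xi}+\overline X_{\xi,m+j}\partial_{\overline w_\xi})$ and $\mathfrak X_{m+j}=\partial_{\overline z_j}+\sum_{\xi=1}^n(X_{\xi,m+j}\partial_{w_\xi}+\overline X_{\xi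 j}\partial_{\overline w_\xi})$. A (non-constant) $\mathbb R$-differentiable function $F\colon G'\to\mathbb C$ is a first integral of (T) if $\mathfrak X_lF=0$ on $G'$, $l=1,\dots,2m$. Form of the functions. Fix integers $0\le s_1,s_2\le m$, $0\le k_1,k_2\le n$, a permutation $(j_1,\dots,j_m)$ of $(1,\dots,m)$ and a permutation $(\zeta_1,\dots,\zeta_n)$ of $(1,\dots,n)$. A function of the form $F({}^sz,{}^kw)$ is an $\mathbb R$-differentiable function on $G'$ that is antiholomorphic in $z_{s_1+1},\dots,z_m,w_{k_1+1},\dots,w_n$ and holomorphic in $z_{j_{s_2+1}},\dots,z_{j_m},w_{\zeta_{k_2+1}},\dots,w_{\zeta_n}$, i.e. $\partial_\chi F=0$ for every $\chi$ in the list $$\mathcal V=\{z_\alpha\ (\alpha>s_1),\ \overline z_{j_\beta}\ (\beta>s_2),\ w_\gamma\ (\gamma>k_1),\ \overline w_{\zeta_\delta}\ (\delta>k_2)\}.$$ A first integral of this form is called $(s_1,s_2)$-nonautonomous and $(n-k_1,n-k_2)$-cylindricality. Notation. $\lambda=k_1+k_2$; for $j=1,\dots,m$, $${}^\lambda X^j=(X_{1j},\dots,X_{k_1j},\overline X_{\zeta_1,m+j},\dots,\overline X_{\zeta_{k_2},m+j}),\quad {}^\lambda X^{m+j}=(X_{1,m+j},\dots,X_{k_1,m+j},\overline X_{\zeta_1j},\dots,\overline X_{\zeta_{k_2}j}).$$ The unknown vector functions, all of whose components have the form $\cdot({}^sz,{}^kw)$, are ${}^{s_1}\psi=(\psi^{(1)}_1,\dots,\psi^{(1)}_{s_1})$,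 ${}^{s_2}\psi=(\psi^{(2)}_1,\dots,\psi^{(2)}_{s_2})$, ${}^{k_1}\varphi=(\varphi^{(1)}_1,\dots,\varphi^{(1)}_{k_1})$, ${}^{k_2}\varphi=(\varphi^{(2)}_1,\dots,\varphi^{(2)}_{k_2})$, ${}^\lambda\varphi=({}^{k_1}\varphi,{}^{k_2}\varphi)$. With $a\cdot b=\sum a_ib_i$, system (E$_0$) on $G'$ is: for every $\chi\in\mathcal V$, $\psi^{(1)}_\theta+{}^\lambda\varphi\cdot{}^\lambda X^\theta=0$, ${}^\lambda\varphi\cdot\partial_\chi^p\,{}^\lambda X^\theta=0$, $p=1,\dots,\lambda$, $\theta=1,\dots,s_1$; ${}^\lambda\varphi\cdot{}^\lambda X^\eta=0$, ${}^\lambda\varphi\cdot\partial_\chi^p\,{}^\lambda X^\eta=0$, $p=1,\dots,\lambda-1$, $\eta=s_1+1,\dots,m$; $\psi^{(2)}_g+{}^\lambda\varphi\cdot{}^\lambda X^{m+j_g}=0$, ${}^\lambda\varphi\cdot\partial_\chi^p\,{}^\lambda X^{m+j_g}=0$, $p=1,\dots,\lambda$, $g=1,\dots,s_2$; ${}^\lambda\varphi\cdot{}^\lambda X^{m+j_\nu}=0$, ${}^\lambda\varphi\cdot\partial_\chi^p\,{}^\lambda X^{m+j_\nu}=0$, $p=1,\dots,\lambda-1$, $\nu=s_2+1,\dots,m$. The Pfaffian equation is $$\omega:=\sum_{\theta=1}^{s_1}\psi^{(1)}_\theta dz_\theta+\sum_{g=1}^{s_2}\psi^{(2)}_gd\overline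 z_{j_g}+\sum_{\xi=1}^{k_1}\varphi^{(1)}_\xi dw_\xi+\sum_{\tau=1}^{k_2}\varphi^{(2)}_\tau d\overline w_{\zeta_\tau}=0.\tag{P}$$ A (non-constant) function $F({}^sz,{}^kw)$ is a general integral of (P) if $\mu\,\omega=dF$ for some non-vanishing function $\mu({}^sz,{}^kw)$ (an integrating factor). *)

theory Defs
  imports "HOL-Analysis.Analysis" "HOL-Combinatorics.Permutations"
begin

(* The spaces C^m and C^n are complex^'m and complex^'n; the linear order on the finite index
   types numbers the coordinates, 1-based, as z_1, ..., z_m and w_1, ..., w_n. *)

definition idx :: "nat \<Rightarrow> 'a::{finite,linorder}" where
  "idx i = sorted_list_of_set UNIV ! (i - 1)"

type_synonym ('m, 'n) point = "(complex^'m) \<times> (complex^'n)"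

definition domain_in :: "'a::topological_space set \<Rightarrow> bool" where
  "domain_in S \<longleftrightarrow> open S \<and> connected S \<and> S \<noteq> {}"

(* The 2m + 2n formal variables of Wirtinger calculus. *)
datatype wvar = Z nat | Zbar nat | W nat | Wbar nat

definition wvars :: "nat \<Rightarrow> nat \<Rightarrow> wvar set" where
  "wvars m n = Z ` {1..m} \<union> Zbar ` {1..m} \<union> W ` {1..n} \<union> Wbar ` {1..n}"

primrec wirtinger ::
  "wvar \<Rightarrow> (('m::{finite,linorder}, 'n::{finite,linorder}) point \<Rightarrow> complex)
    \<Rightarrow> ('m, 'n) point \<Rightarrow> complex" where
  "wirtinger (Z j) f x =
     (frechet_derivative f (at x) (axis (idx j) 1, 0)
      - \<i> * frechet_derivative f (at x) (axis (idx j) \<i>, 0)) / 2"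
| "wirtinger (Zbar j) f x =
     (frechet_derivative f (at x) (axis (idx j) 1, 0)
      + \<i> * frechet_derivative f (at x) (axis (idx j) \<i>, 0)) / 2"
| "wirtinger (W \<xi>) f x =
     (frechet_derivative f (at x) (0, axis (idx \<xi>) 1)
      - \<i> * frechet_derivative f (at x) (0, axis (idx \<xi>) \<i>)) / 2"
| "wirtinger (Wbar \<xi>) f x =
     (frechet_derivative f (at x) (0, axis (idx \<xi>) 1)
      + \<i> * frechet_derivative f (at x) (0, axis (idx \<xi>) \<i>)) / 2"

primrec differential ::
  "wvar \<Rightarrow> ('m::{finite,linorder}, 'n::{finite,linorder}) point \<Rightarrow> complex" where
  "differential (Z j) v = fst v $ idx j"
| "differential (Zbar j) v = cnj (fst v $ idx j)"
| "differential (W \<xi>) v = snd v $ idx \<xi>"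
| "differential (Wbar \<xi>) v = cnj (snd v $ idx \<xi>)"

definition twice_R_differentiable_on ::
  "(('m::{finite,linorder}, 'n::{finite,linorder}) point \<Rightarrow> complex)
    \<Rightarrow> ('m, 'n) point set \<Rightarrow> bool" where
  "twice_R_differentiable_on F U \<longleftrightarrow>
     F differentiable_on U \<and>
     (\<forall>\<kappa> \<in> wvars CARD('m) CARD('n). wirtinger \<kappa> F differentiable_on U)"

(* X \<xi> l, for \<xi> in {1..n} and l in {1..2m}, is the coefficient X_{\<xi> l} of dz_l (l \<le> m)
   or of the differential of the conjugate of z_{l-m} (l > m) in the expression of dw_\<xi> by a system of
   total differential equations. *)
type_synonym ('m, 'n) coeffs = "nat \<Rightarrow> nat \<Rightarrow> ('m, 'n) point \<Rightarrow> complex"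

(* Exchanges the positions j and m + j. *)
definition swap_index :: "nat \<Rightarrow> nat \<Rightarrow> nat" where
  "swap_index m l = (if l \<le> m then m + l else l - m)"

definition op_X ::
  "('m::{finite,linorder}, 'n::{finite,linorder}) coeffs \<Rightarrow> nat
    \<Rightarrow> (('m, 'n) point \<Rightarrow> complex) \<Rightarrow> ('m, 'n) point \<Rightarrow> complex" where
  "op_X X l F x =
     wirtinger (if l \<le> CARD('m) then Z l else Zbar (l - CARD('m))) F x
     + (\<Sum>\<xi>=1..CARD('n). X \<xi> l x * wirtinger (W \<xi>) F x
          + cnj (X \<xi> (swap_index CARD('m) l) x) * wirtinger (Wbar \<xi>) F x)"

definition first_integral ::
  "('m::{finite,linorder}, 'n::{finite,linorder}) coeffs \<Rightarrow> ('m, 'n) point set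
    \<Rightarrow> (('m, 'n) point \<Rightarrow> complex) \<Rightarrow> bool" where
  "first_integral X G' F \<longleftrightarrow>
     F differentiable_on G' \<and> \<not> F constant_on G' \<and>
     (\<forall>l\<in>{1..2 * CARD('m)}. \<forall>x\<in>G'. op_X X l F x = 0)"

definition annihilated_vars ::
  "nat \<Rightarrow> nat \<Rightarrow> nat \<Rightarrow> nat \<Rightarrow> nat \<Rightarrow> nat \<Rightarrow> (nat \<Rightarrow> nat) \<Rightarrow> (nat \<Rightarrow> nat) \<Rightarrow> wvar set" where
  "annihilated_vars m n s1 s2 k1 k2 j \<zeta> =
     Z ` {s1+1..m} \<union> (\<lambda>\<beta>. Zbar (j \<beta>)) ` {s2+1..m}
     \<union> W ` {k1+1..n} \<union> (\<lambda>\<delta>. Wbar (\<zeta> \<delta>)) ` {k2+1..n}"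

(* The form F(^s z, ^k w), for V the set of annihilated variables. *)
definition has_form ::
  "wvar set \<Rightarrow> ('m::{finite,linorder}, 'n::{finite,linorder}) point set
    \<Rightarrow> (('m, 'n) point \<Rightarrow> complex) \<Rightarrow> bool" where
  "has_form V G' f \<longleftrightarrow>
     f differentiable_on G' \<and> (\<forall>\<kappa>\<in>V. \<forall>x\<in>G'. wirtinger \<kappa> f x = 0)"

definition concat_vec :: "nat \<Rightarrow> (nat \<Rightarrow> 'a) \<Rightarrow> (nat \<Rightarrow> 'a) \<Rightarrow> nat \<Rightarrow> 'a" where
  "concat_vec k a b i = (if i \<le> k then a i else b (i - k))"

(* The vector function ^\<lambda> X^l; its components are numbered 1, ..., k1 + k2. *)
definition lambda_X ::
  "nat \<Rightarrow> (nat \<Rightarrow> nat) \<Rightarrow> ('m::{finite,linorder}, 'n::{finite,linorder}) coeffs \<Rightarrow> nat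
    \<Rightarrow> nat \<Rightarrow> ('m, 'n) point \<Rightarrow> complex" where
  "lambda_X k1 \<zeta> X l =
     concat_vec k1 (\<lambda>\<xi>. X \<xi> l) (\<lambda>\<tau> x. cnj (X (\<zeta> \<tau>) (swap_index CARD('m) l) x))"

definition dot ::
  "nat \<Rightarrow> (nat \<Rightarrow> 'p \<Rightarrow> complex) \<Rightarrow> (nat \<Rightarrow> 'p \<Rightarrow> complex) \<Rightarrow> 'p \<Rightarrow> complex" where
  "dot N a b x = (\<Sum>i=1..N. a i x * b i x)"

definition dot_deriv ::
  "nat \<Rightarrow> (nat \<Rightarrow> ('m::{finite,linorder}, 'n::{finite,linorder}) point \<Rightarrow> complex)
    \<Rightarrow> wvar \<Rightarrow> nat \<Rightarrow> (nat \<Rightarrow> ('m, 'n) point \<Rightarrow> complex) \<Rightarrow> ('m, 'n) point \<Rightarrow> complex" where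
  "dot_deriv N a \<kappa> p b = dot N a (\<lambda>i. (wirtinger \<kappa> ^^ p) (b i))"

(* The derivatives of the coefficients occurring in system_E0 exist: the p-th power of
   wirtinger \<kappa> is meaningful once all lower powers are differentiable. *)
definition coeff_derivs_exist ::
  "wvar set \<Rightarrow> nat \<Rightarrow> nat \<Rightarrow> nat \<Rightarrow> nat \<Rightarrow> (nat \<Rightarrow> nat) \<Rightarrow> (nat \<Rightarrow> nat)
    \<Rightarrow> ('m::{finite,linorder}, 'n::{finite,linorder}) point set \<Rightarrow> ('m, 'n) coeffs \<Rightarrow> bool" where
  "coeff_derivs_exist V s1 s2 k1 k2 j \<zeta> G' X \<longleftrightarrow>
     (\<forall>\<kappa>\<in>V. \<forall>i\<in>{1..k1 + k2}.
        (\<forall>l \<in> {1..s1} \<union> (\<lambda>g. CARD('m) + j g) ` {1..s2}. \<forall>p < k1 + k2.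
           (wirtinger \<kappa> ^^ p) (lambda_X k1 \<zeta> X l i) differentiable_on G') \<and>
        (\<forall>l \<in> {s1+1..CARD('m)} \<union> (\<lambda>\<nu>. CARD('m) + j \<nu>) ` {s2+1..CARD('m)}. \<forall>p < k1 + k2 - 1.
           (wirtinger \<kappa> ^^ p) (lambda_X k1 \<zeta> X l i) differentiable_on G'))"

(* The equations without \<kappa> are imposed also when V is empty. *)
definition system_E0 ::
  "wvar set \<Rightarrow> nat \<Rightarrow> nat \<Rightarrow> nat \<Rightarrow> nat \<Rightarrow> (nat \<Rightarrow> nat) \<Rightarrow> (nat \<Rightarrow> nat)
    \<Rightarrow> ('m::{finite,linorder}, 'n::{finite,linorder}) point set \<Rightarrow> ('m, 'n) coeffs
    \<Rightarrow> (nat \<Rightarrow> ('m, 'n) point \<Rightarrow> complex) \<Rightarrow> (nat \<Rightarrow> ('m, 'n) point \<Rightarrow> complex)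
    \<Rightarrow> (nat \<Rightarrow> ('m, 'n) point \<Rightarrow> complex) \<Rightarrow> (nat \<Rightarrow> ('m, 'n) point \<Rightarrow> complex) \<Rightarrow> bool" where
  "system_E0 V s1 s2 k1 k2 j \<zeta> G' X \<psi>1 \<psi>2 \<phi>1 \<phi>2 \<longleftrightarrow>
     (\<forall>x\<in>G'.
       (\<forall>\<theta>\<in>{1..s1}.
          \<psi>1 \<theta> x + dot (k1 + k2) (concat_vec k1 \<phi>1 \<phi>2) (lambda_X k1 \<zeta> X \<theta>) x = 0 \<and>
          (\<forall>\<kappa>\<in>V. \<forall>p\<in>{1..k1 + k2}.
             dot_deriv (k1 + k2) (concat_vec k1 \<phi>1 \<phi>2) \<kappa> p (lambda_X k1 \<zeta> X \<theta>) x = 0)) \<and>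
       (\<forall>\<eta>\<in>{s1+1..CARD('m)}.
          dot (k1 + k2) (concat_vec k1 \<phi>1 \<phi>2) (lambda_X k1 \<zeta> X \<eta>) x = 0 \<and>
          (\<forall>\<kappa>\<in>V. \<forall>p\<in>{1..k1 + k2 - 1}.
             dot_deriv (k1 + k2) (concat_vec k1 \<phi>1 \<phi>2) \<kappa> p (lambda_X k1 \<zeta> X \<eta>) x = 0)) \<and>
       (\<forall>g\<in>{1..s2}.
          \<psi>2 g x + dot (k1 + k2) (concat_vec k1 \<phi>1 \<phi>2)
                       (lambda_X k1 \<zeta> X (CARD('m) + j g)) x = 0 \<and>
          (\<forall>\<kappa>\<in>V. \<forall>p\<in>{1..k1 + k2}.
             dot_deriv (k1 + k2) (concat_vec k1 \<phi>1 \<phi>2) \<kappa> p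
                       (lambda_X k1 \<zeta> X (CARD('m) + j g)) x = 0)) \<and>
       (\<forall>\<nu>\<in>{s2+1..CARD('m)}.
          dot (k1 + k2) (concat_vec k1 \<phi>1 \<phi>2) (lambda_X k1 \<zeta> X (CARD('m) + j \<nu>)) x = 0 \<and>
          (\<forall>\<kappa>\<in>V. \<forall>p\<in>{1..k1 + k2 - 1}.
             dot_deriv (k1 + k2) (concat_vec k1 \<phi>1 \<phi>2) \<kappa> p
                       (lambda_X k1 \<zeta> X (CARD('m) + j \<nu>)) x = 0)))"

definition pfaff_form ::
  "nat \<Rightarrow> nat \<Rightarrow> nat \<Rightarrow> nat \<Rightarrow> (nat \<Rightarrow> nat) \<Rightarrow> (nat \<Rightarrow> nat)
    \<Rightarrow> (nat \<Rightarrow> ('m::{finite,linorder}, 'n::{finite,linorder}) point \<Rightarrow> complex)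
    \<Rightarrow> (nat \<Rightarrow> ('m, 'n) point \<Rightarrow> complex)
    \<Rightarrow> (nat \<Rightarrow> ('m, 'n) point \<Rightarrow> complex) \<Rightarrow> (nat \<Rightarrow> ('m, 'n) point \<Rightarrow> complex)
    \<Rightarrow> ('m, 'n) point \<Rightarrow> ('m, 'n) point \<Rightarrow> complex" where
  "pfaff_form s1 s2 k1 k2 j \<zeta> \<psi>1 \<psi>2 \<phi>1 \<phi>2 x v =
     (\<Sum>\<theta>=1..s1. \<psi>1 \<theta> x * differential (Z \<theta>) v)
     + (\<Sum>g=1..s2. \<psi>2 g x * differential (Zbar (j g)) v)
     + (\<Sum>\<xi>=1..k1. \<phi>1 \<xi> x * differential (W \<xi>) v)
     + (\<Sum>\<tau>=1..k2. \<phi>2 \<tau> x * differential (Wbar (\<zeta> \<tau>)) v)"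

(* The has_derivative clause is the identity \<mu> \<omega> = dF of complex-valued R-linear forms. *)
definition general_integral ::
  "wvar set \<Rightarrow> ('m::{finite,linorder}, 'n::{finite,linorder}) point set
    \<Rightarrow> (('m, 'n) point \<Rightarrow> ('m, 'n) point \<Rightarrow> complex)
    \<Rightarrow> (('m, 'n) point \<Rightarrow> complex) \<Rightarrow> bool" where
  "general_integral V G' \<omega> F \<longleftrightarrow>
     has_form V G' F \<and> \<not> F constant_on G' \<and>
     (\<exists>\<mu>. has_form V G' \<mu> \<and> (\<forall>x\<in>G'. \<mu> x \<noteq> 0) \<and>
          (\<forall>x\<in>G'. (F has_derivative (\<lambda>v. \<mu> x * \<omega> x v)) (at x)))"

(* There are \<psi>, \<phi> of the required form that satisfy system_E0 and for which F is a general
   integral of the Pfaffian equation pfaff_form = 0. *)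
definition generated_by_E0 ::
  "wvar set \<Rightarrow> nat \<Rightarrow> nat \<Rightarrow> nat \<Rightarrow> nat \<Rightarrow> (nat \<Rightarrow> nat) \<Rightarrow> (nat \<Rightarrow> nat)
    \<Rightarrow> ('m::{finite,linorder}, 'n::{finite,linorder}) point set \<Rightarrow> ('m, 'n) coeffs
    \<Rightarrow> (('m, 'n) point \<Rightarrow> complex) \<Rightarrow> bool" where
  "generated_by_E0 V s1 s2 k1 k2 j \<zeta> G' X F \<longleftrightarrow>
     (\<exists>\<psi>1 \<psi>2 \<phi>1 \<phi>2.
        (\<forall>\<theta>\<in>{1..s1}. has_form V G' (\<psi>1 \<theta>)) \<and>
        (\<forall>g\<in>{1..s2}. has_form V G' (\<psi>2 g)) \<and>
        (\<forall>\<xi>\<in>{1..k1}. has_form V G' (\<phi>1 \<xi>)) \<and>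
        (\<forall>\<tau>\<in>{1..k2}. has_form V G' (\<phi>2 \<tau>)) \<and>
        system_E0 V s1 s2 k1 k2 j \<zeta> G' X \<psi>1 \<psi>2 \<phi>1 \<phi>2 \<and>
        general_integral V G' (pfaff_form s1 s2 k1 k2 j \<zeta> \<psi>1 \<psi>2 \<phi>1 \<phi>2) F)"

end

theory Submission
  imports Defs
begin

text \<open>
  A real-linear form on \<open>\<complex>\<^sup>m \<times> \<complex>\<^sup>n\<close> is determined by its coefficients with respect to
  \<open>dz\<close>, \<open>dzbar\<close>, \<open>dw\<close>, \<open>dwbar\<close>, and the Wirtinger derivatives of \<open>F\<close> at a point are the
  coefficients of \<open>dF\<close> there.  If \<open>F\<close> has the required form, then \<open>dF\<close> involves only the
  differentials of the variables outside \<open>V\<close>, so \<open>dF = \<mu> \<omega>\<close> says exactly that \<open>\<psi>\<close> and \<open>\<phi>\<close>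
  are, up to the factor \<open>\<mu>\<close>, the derivatives of \<open>F\<close> with respect to those variables.  Under this
  dictionary the undifferentiated equations of the functional system are the equations
  \<open>op_X X l F = 0\<close> divided by \<open>\<mu>\<close> (lemma \<open>op_X_eq_dot\<close>).

  Given a solution of the functional system together with \<open>\<mu>\<close>, comparing coefficients
  (lemma \<open>form_coeff_pfaff_form\<close>) therefore shows at once that \<open>F\<close> is a first integral.

  Conversely, for a first integral \<open>F\<close> take \<open>\<mu> = 1\<close> and let \<open>\<psi>\<close>, \<open>\<phi>\<close> be the derivatives of \<open>F\<close>
  themselves.  Two things remain.  These derivatives must again be annihilated by \<open>\<partial>\<^sub>\<chi>\<close> for
  \<open>\<chi> \<in> V\<close>; since \<open>\<partial>\<^sub>\<chi> F\<close> vanishes identically, this amounts to commuting Wirtinger derivatives.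
  As the second derivatives of \<open>F\<close> are not assumed continuous, the symmetry used is the pointwise
  one for twice differentiable functions (lemma \<open>second_derivative_symmetric\<close>).  Finally, the
  differentiated equations follow by applying \<open>\<partial>\<^sub>\<chi>\<close> repeatedly to the undifferentiated ones:
  \<open>\<psi>\<close> and \<open>\<phi>\<close> behave like constants, so that all derivatives fall on the coefficients
  (lemma \<open>dot_deriv_eq_zero\<close>).
\<close>

section \<open>Symmetry of the second derivative\<close>

text \<open>
  For small fixed \<open>t\<close>, the mixed difference is the increment over \<open>[0, t]\<close> of
  \<open>s \<mapsto> f (x + s u + t v) - f (x + s u)\<close>.  The derivative of this function is a difference of values
  of \<open>f' _ u\<close> at two points that differ by \<open>t v\<close>, hence equals \<open>t A v\<close> up to \<open>o(t)\<close> by the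
  differentiability of \<open>f' _ u\<close> at the single point \<open>x\<close>, and the mean value theorem integrates the
  estimate.
\<close>
lemma mixed_second_difference:
  fixes f :: "'a::real_normed_vector \<Rightarrow> 'b::real_inner"
  assumes "open S" "x \<in> S"
    and f': "\<And>y. y \<in> S \<Longrightarrow> (f has_derivative f' y) (at y)"
    and A: "((\<lambda>y. f' y u) has_derivative A) (at x)"
    and "e > 0"
  shows "\<forall>\<^sub>F t in at_right 0.
    norm (f (x + t *\<^sub>R u + t *\<^sub>R v) - f (x + t *\<^sub>R u) - f (x + t *\<^sub>R v) + f x - t\<^sup>2 *\<^sub>R A v) \<le> e * t\<^sup>2"
proof -
  (* All points used lie within t * K of x, so the error is at most t * (e' * tK + e' * tK) = e * t^2. *)
  define K where "K = 2 * (norm u + norm v) + 1"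
  have "K > 0" by (simp add: K_def add_nonneg_pos)
  interpret A: bounded_linear A by (rule has_derivative_bounded_linear[OF A])
  define e' where "e' = e / (2 * K)"
  have "e' > 0" using \<open>e > 0\<close> \<open>K > 0\<close> by (simp add: e'_def)
  obtain d1 where "d1 > 0" and d1: "\<And>y. norm (y - x) < d1 \<Longrightarrow>
      norm (f' y u - f' x u - A (y - x)) \<le> e' * norm (y - x)"
    using A[unfolded has_derivative_at_alt] \<open>e' > 0\<close> by blast
  obtain d2 where "d2 > 0" and d2: "\<And>y. norm (y - x) < d2 \<Longrightarrow> y \<in> S"
    using \<open>open S\<close> \<open>x \<in> S\<close> by (metis dist_norm open_dist)
  define d where "d = min d1 d2 / K"
  have "d > 0" using \<open>d1 > 0\<close> \<open>d2 > 0\<close> \<open>K > 0\<close> by (simp add: d_def)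
  have "norm (f (x + t *\<^sub>R u + t *\<^sub>R v) - f (x + t *\<^sub>R u) - f (x + t *\<^sub>R v) + f x - t\<^sup>2 *\<^sub>R A v) \<le> e * t\<^sup>2"
    if "0 < t" "t < d" for t
  proof -
    have small: "norm (s *\<^sub>R u + r *\<^sub>R v) < min d1 d2" "norm (s *\<^sub>R u + r *\<^sub>R v) \<le> t * K"
      if "0 \<le> s" "s \<le> t" "0 \<le> r" "r \<le> t" for s r
    proof -
      have "norm (s *\<^sub>R u + r *\<^sub>R v) \<le> s * norm u + r * norm v"
        using norm_triangle_ineq[of "s *\<^sub>R u" "r *\<^sub>R v"] that by simp
      also have "\<dots> \<le> t * norm u + t * norm v"
        using that by (intro add_mono mult_right_mono) auto
      also have "\<dots> \<le> t * K"
        unfolding K_def using \<open>0 < t\<close> by (simp add: algebra_simps)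
      finally show *: "norm (s *\<^sub>R u + r *\<^sub>R v) \<le> t * K" .
      have "t * K < d * K" using \<open>t < d\<close> \<open>K > 0\<close> by simp
      with * show "norm (s *\<^sub>R u + r *\<^sub>R v) < min d1 d2"
        using \<open>K > 0\<close> by (simp add: d_def)
    qed
    define g where "g s = f (x + s *\<^sub>R u + t *\<^sub>R v) - f (x + s *\<^sub>R u) - (s * t) *\<^sub>R A v" for s
    define g' where "g' s h = f' (x + s *\<^sub>R u + t *\<^sub>R v) (h *\<^sub>R u) - f' (x + s *\<^sub>R u) (h *\<^sub>R u)
      - (h * t) *\<^sub>R A v" for s h
    have in_S: "x + s *\<^sub>R u + t *\<^sub>R v \<in> S" "x + s *\<^sub>R u \<in> S" if "0 \<le> s" "s \<le> t" for s
      using d2[of "x + s *\<^sub>R u + t *\<^sub>R v"] d2[of "x + s *\<^sub>R u"]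
        small(1)[of s t] small(1)[of s 0] that \<open>0 < t\<close> by (simp_all add: algebra_simps)
    have g': "(g has_derivative g' s) (at s)" if s: "0 \<le> s" "s \<le> t" for s
    proof -
      have 1: "((\<lambda>s. f (x + s *\<^sub>R u + t *\<^sub>R v)) has_derivative
          (\<lambda>h. f' (x + s *\<^sub>R u + t *\<^sub>R v) (h *\<^sub>R u))) (at s)"
        by (rule has_derivative_compose[where f = "\<lambda>s. x + s *\<^sub>R u + t *\<^sub>R v", OF _ f'[OF in_S(1)[OF s]]])
          (auto intro!: derivative_eq_intros)
      have 2: "((\<lambda>s. f (x + s *\<^sub>R u)) has_derivative (\<lambda>h. f' (x + s *\<^sub>R u) (h *\<^sub>R u))) (at s)"
        by (rule has_derivative_compose[where f = "\<lambda>s. x + s *\<^sub>R u", OF _ f'[OF in_S(2)[OF s]]])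
          (auto intro!: derivative_eq_intros)
      show ?thesis unfolding g_def g'_def
        by (rule has_derivative_diff has_derivative_scaleR_left has_derivative_mult_left
            has_derivative_ident 1 2)+
    qed
    have "continuous_on {0..t} g"
      by (rule has_derivative_continuous_on[where f' = g'])
        (auto intro: has_derivative_at_withinI g')
    then obtain s where s: "s \<in> {0<..<t}" and le: "norm (g t - g 0) \<le> norm (g' s (t - 0))"
      using mvt_general[OF \<open>0 < t\<close>, of g g'] g' by auto
    have lin: "f' y (t *\<^sub>R u) = t *\<^sub>R f' y u" if "y \<in> S" for y
      using f'[OF that] by (intro linear_scale has_derivative_linear)
    let ?a = "s *\<^sub>R u + t *\<^sub>R v" and ?b = "s *\<^sub>R u + 0 *\<^sub>R v"
    (* Both values of f' _ u are compared with the linearisation at x; the linear parts differ by t * A v. *)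
    have "g' s t = t *\<^sub>R ((f' (x + ?a) u - f' x u - A ?a) - (f' (x + ?b) u - f' x u - A ?b))"
      unfolding g'_def using in_S[of s] s
      by (simp add: lin A.add A.scaleR algebra_simps)
    also have "norm \<dots> \<le> t * (e' * norm ?a + e' * norm ?b)"
    proof -
      have "norm (f' (x + ?a) u - f' x u - A ?a) \<le> e' * norm ?a"
        using d1[of "x + ?a"] small(1)[of s t] s by simp
      moreover have "norm (f' (x + ?b) u - f' x u - A ?b) \<le> e' * norm ?b"
        using d1[of "x + ?b"] small(1)[of s 0] s by simp
      ultimately show ?thesis
        using \<open>0 < t\<close> norm_triangle_ineq4[of "f' (x + ?a) u - f' x u - A ?a" "f' (x + ?b) u - f' x u - A ?b"]
        by simp
    qed
    also have "\<dots> \<le> t * (e' * (t * K) + e' * (t * K))"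
      using small(2)[of s t] small(2)[of s 0] s \<open>0 < t\<close> \<open>e' > 0\<close>
      by (intro mult_left_mono add_mono) auto
    also have "\<dots> = e * t\<^sup>2"
      using \<open>K > 0\<close> by (simp add: e'_def power2_eq_square field_simps)
    finally have "norm (g t - g 0) \<le> e * t\<^sup>2" using le by simp
    then show ?thesis
      by (simp add: g_def power2_eq_square algebra_simps)
  qed
  then show ?thesis
    using \<open>d > 0\<close> by (auto simp: eventually_at_right)
qed

text \<open>
  The mixed second difference is invariant under exchanging \<open>u\<close> and \<open>v\<close>, and its leading term is
  \<open>t\<^sup>2 A v\<close> by one reading and \<open>t\<^sup>2 B u\<close> by the other.
\<close>
lemma second_derivative_symmetric:
  fixes f :: "'a::real_normed_vector \<Rightarrow> 'b::real_inner"
  assumes S: "open S" "x \<in> S"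
    and f': "\<And>y. y \<in> S \<Longrightarrow> (f has_derivative f' y) (at y)"
    and A: "((\<lambda>y. f' y u) has_derivative A) (at x)"
    and B: "((\<lambda>y. f' y v) has_derivative B) (at x)"
  shows "A v = B u"
proof -
  have "norm (A v - B u) \<le> e" if "e > 0" for e
  proof -
    have "e / 2 > 0" using that by simp
    from eventually_conj[OF eventually_at_right_less eventually_conj[OF
        mixed_second_difference[where v = v, OF S f' A this]
        mixed_second_difference[where v = u, OF S f' B this]]]
    obtain t :: real where "0 < t"
      and 1: "norm (f (x + t *\<^sub>R u + t *\<^sub>R v) - f (x + t *\<^sub>R u) - f (x + t *\<^sub>R v) + f x - t\<^sup>2 *\<^sub>R A v)
        \<le> e / 2 * t\<^sup>2"
      and 2: "norm (f (x + t *\<^sub>R v + t *\<^sub>R u) - f (x + t *\<^sub>R v) - f (x + t *\<^sub>R u) + f x - t\<^sup>2 *\<^sub>R B u)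
        \<le> e / 2 * t\<^sup>2"
      by (fastforce dest: eventually_happens'[OF trivial_limit_at_right_real])
    let ?D = "f (x + t *\<^sub>R u + t *\<^sub>R v) - f (x + t *\<^sub>R u) - f (x + t *\<^sub>R v) + f x"
    have "f (x + t *\<^sub>R v + t *\<^sub>R u) - f (x + t *\<^sub>R v) - f (x + t *\<^sub>R u) + f x = ?D"
      by (simp add: algebra_simps)
    with 2 have 2: "norm (?D - t\<^sup>2 *\<^sub>R B u) \<le> e / 2 * t\<^sup>2" by simp
    have "t\<^sup>2 * norm (A v - B u) = norm ((?D - t\<^sup>2 *\<^sub>R B u) - (?D - t\<^sup>2 *\<^sub>R A v))"
      by (simp add: scaleR_diff_right[symmetric])
    also have "\<dots> \<le> e / 2 * t\<^sup>2 + e / 2 * t\<^sup>2"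
      by (rule order_trans[OF norm_triangle_ineq4 add_mono[OF 2 1]])
    finally have "t\<^sup>2 * norm (A v - B u) \<le> t\<^sup>2 * e" by (simp add: algebra_simps)
    then show ?thesis using \<open>0 < t\<close> by simp
  qed
  then have "norm (A v - B u) \<le> 0" by (rule field_le_epsilon) simp
  then show ?thesis by simp
qed

section \<open>Wirtinger derivatives as coefficients of real-linear forms\<close>

primrec coord_direction ::
  "wvar \<Rightarrow> complex \<Rightarrow> ('m::{finite,linorder}, 'n::{finite,linorder}) point" where
  "coord_direction (Z j) a = (axis (idx j) a, 0)"
| "coord_direction (Zbar j) a = (axis (idx j) a, 0)"
| "coord_direction (W \<xi>) a = (0, axis (idx \<xi>) a)"
| "coord_direction (Wbar \<xi>) a = (0, axis (idx \<xi>) a)"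

primrec wirtinger_unit :: "wvar \<Rightarrow> complex" where
  "wirtinger_unit (Z j) = - \<i>"
| "wirtinger_unit (Zbar j) = \<i>"
| "wirtinger_unit (W \<xi>) = - \<i>"
| "wirtinger_unit (Wbar \<xi>) = \<i>"

text \<open>
  The coefficient of the differential of \<open>\<kappa>\<close> in a real-linear form \<open>L\<close>.  Splitting it from the
  derivative turns the rules for Wirtinger derivatives into linear algebra.
\<close>
definition form_coeff ::
  "wvar \<Rightarrow> (('m::{finite,linorder}, 'n::{finite,linorder}) point \<Rightarrow> complex) \<Rightarrow> complex" where
  "form_coeff \<kappa> L = (L (coord_direction \<kappa> 1) + wirtinger_unit \<kappa> * L (coord_direction \<kappa> \<i>)) / 2"

lemma wirtinger_eq_form_coeff:
  "wirtinger \<kappa> f x = form_coeff \<kappa> (frechet_derivative f (at x))"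
  by (cases \<kappa>) (simp_all add: form_coeff_def)

lemma wirtinger_has_derivative:
  "(f has_derivative f') (at x) \<Longrightarrow> wirtinger \<kappa> f x = form_coeff \<kappa> f'"
  by (simp add: wirtinger_eq_form_coeff frechet_derivative_at[symmetric])

lemma form_coeff_add: "form_coeff \<kappa> (\<lambda>v. L v + M v) = form_coeff \<kappa> L + form_coeff \<kappa> M"
  by (simp add: form_coeff_def field_simps)

lemma form_coeff_mult: "form_coeff \<kappa> (\<lambda>v. c * L v) = c * form_coeff \<kappa> L"
  by (simp add: form_coeff_def field_simps)

lemma form_coeff_zero: "form_coeff \<kappa> (\<lambda>v. 0) = 0"
  by (simp add: form_coeff_def)

lemma form_coeff_sum: "form_coeff \<kappa> (\<lambda>v. \<Sum>i\<in>I. L i v) = (\<Sum>i\<in>I. form_coeff \<kappa> (L i))"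
  by (induction I rule: infinite_finite_induct)
    (simp_all add: form_coeff_add form_coeff_zero)

lemma bij_betw_idx: "bij_betw idx {1..CARD('a)} (UNIV :: 'a::{finite,linorder} set)"
proof -
  let ?xs = "sorted_list_of_set (UNIV :: 'a set)"
  have "bij_betw ((!) ?xs) {..<CARD('a)} UNIV"
    by (rule bij_betw_nth) auto
  moreover have "bij_betw (\<lambda>i. i - 1) {1..CARD('a)} {..<CARD('a)}"
    by (rule bij_betw_byWitness[where f' = Suc]) auto
  ultimately have "bij_betw ((!) ?xs \<circ> (\<lambda>i. i - 1)) {1..CARD('a)} UNIV"
    by (rule bij_betw_trans[rotated])
  then show ?thesis by (simp add: idx_def[abs_def] o_def)
qed

lemma idx_eq_iff:
  "i \<in> {1..CARD('a)} \<Longrightarrow> k \<in> {1..CARD('a)} \<Longrightarrow>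
    (idx i :: 'a::{finite,linorder}) = idx k \<longleftrightarrow> i = k"
  using bij_betw_idx by (metis bij_betw_imp_inj_on inj_on_eq_iff)

text \<open>The coefficient functionals form the basis dual to the differentials.\<close>
lemma form_coeff_differential:
  assumes "\<kappa> \<in> wvars CARD('m) CARD('n)" "\<kappa>' \<in> wvars CARD('m) CARD('n)"
  shows "form_coeff \<kappa> (differential \<kappa>' :: ('m::{finite,linorder}, 'n::{finite,linorder}) point \<Rightarrow> complex)
    = of_bool (\<kappa> = \<kappa>')"
  using assms idx_eq_iff[where 'a = 'm] idx_eq_iff[where 'a = 'n]
  by (auto simp: wvars_def form_coeff_def axis_def split: if_splits)

lemma sum_axis_idx:
  "(\<Sum>i=1..CARD('a). axis (idx i) (v $ idx i)) = (v :: complex ^ 'a::{finite,linorder})"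
proof -
  have "(\<Sum>i=1..CARD('a). axis (idx i) (v $ idx i)) = (\<Sum>a\<in>UNIV. axis a (v $ a))"
    by (rule sum.reindex_bij_betw[OF bij_betw_idx])
  also have "\<dots> = v" by (simp add: vec_eq_iff axis_def if_distrib cong: if_cong)
  finally show ?thesis .
qed

text \<open>
  Substitute \<open>Re a = (a + cnj a) / 2\<close> and \<open>Im a = (a - cnj a) / (2\<i>)\<close> in \<open>Re a L(1) + Im a L(\<i>)\<close>.
\<close>
lemma real_linear_complex:
  fixes L :: "complex \<Rightarrow> complex"
  assumes "linear L"
  shows "L a = (L 1 - \<i> * L \<i>) / 2 * a + (L 1 + \<i> * L \<i>) / 2 * cnj a"
proof -
  have "a = Re a *\<^sub>R 1 + Im a *\<^sub>R \<i>" by (simp add: complex_eq_iff)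
  then have "L a = Re a *\<^sub>R L 1 + Im a *\<^sub>R L \<i>"
    using assms by (metis linear_add linear_scale)
  then show ?thesis by (simp add: complex_eq_iff field_simps)
qed

text \<open>Apply the one-variable decomposition on each coordinate line.\<close>
lemma real_linear_form_expansion:
  fixes L :: "('m::{finite,linorder}, 'n::{finite,linorder}) point \<Rightarrow> complex"
  assumes "linear L"
  shows "L v =
    (\<Sum>i=1..CARD('m). form_coeff (Z i) L * differential (Z i) v)
    + (\<Sum>i=1..CARD('m). form_coeff (Zbar i) L * differential (Zbar i) v)
    + (\<Sum>\<xi>=1..CARD('n). form_coeff (W \<xi>) L * differential (W \<xi>) v)
    + (\<Sum>\<xi>=1..CARD('n). form_coeff (Wbar \<xi>) L * differential (Wbar \<xi>) v)"
proof -
  have add1: "(axis i (a + b), 0) = (axis i a, 0) + (axis i b, 0 :: (complex, 'n) vec)"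
    and scale1: "(axis i (r *\<^sub>R a), 0) = r *\<^sub>R (axis i a, 0 :: (complex, 'n) vec)"
    for i :: 'm and a b :: complex and r
    by (simp_all add: axis_def vec_eq_iff)
  have add2: "(0, axis i (a + b)) = (0, axis i a) + (0 :: (complex, 'm) vec, axis i b)"
    and scale2: "(0, axis i (r *\<^sub>R a)) = r *\<^sub>R (0 :: (complex, 'm) vec, axis i a)"
    for i :: 'n and a b :: complex and r
    by (simp_all add: axis_def vec_eq_iff)
  have lin1: "linear (\<lambda>a. L (axis i a, 0))" for i
    by (rule linearI) (simp_all only: add1 scale1 linear_add[OF assms] linear_scale[OF assms])
  have lin2: "linear (\<lambda>a. L (0, axis i a))" for i
    by (rule linearI) (simp_all only: add2 scale2 linear_add[OF assms] linear_scale[OF assms])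
  have "v = (\<Sum>i=1..CARD('m). (axis (idx i) (fst v $ idx i), 0))
      + (\<Sum>\<xi>=1..CARD('n). (0, axis (idx \<xi>) (snd v $ idx \<xi>)))"
    by (simp add: prod_eq_iff fst_sum snd_sum sum_axis_idx del: One_nat_def)
  from arg_cong[OF this, of L]
  have "L v = (\<Sum>i=1..CARD('m). L (axis (idx i) (fst v $ idx i), 0))
      + (\<Sum>\<xi>=1..CARD('n). L (0, axis (idx \<xi>) (snd v $ idx \<xi>)))"
    by (simp only: linear_add[OF assms] linear_sum[OF assms])
  also have "(\<Sum>i=1..CARD('m). L (axis (idx i) (fst v $ idx i), 0)) =
    (\<Sum>i=1..CARD('m). form_coeff (Z i) L * differential (Z i) v
      + form_coeff (Zbar i) L * differential (Zbar i) v)"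
    by (rule sum.cong[OF refl], subst real_linear_complex[OF lin1]) (simp add: form_coeff_def)
  also have "(\<Sum>\<xi>=1..CARD('n). L (0, axis (idx \<xi>) (snd v $ idx \<xi>))) =
    (\<Sum>\<xi>=1..CARD('n). form_coeff (W \<xi>) L * differential (W \<xi>) v
      + form_coeff (Wbar \<xi>) L * differential (Wbar \<xi>) v)"
    by (rule sum.cong[OF refl], subst real_linear_complex[OF lin2]) (simp add: form_coeff_def)
  finally show ?thesis by (simp add: sum.distrib add.assoc)
qed


section \<open>Calculus of Wirtinger derivatives\<close>

lemma differentiable_on_openD:
  "f differentiable_on U \<Longrightarrow> open U \<Longrightarrow> x \<in> U \<Longrightarrow> f differentiable (at x)"
  by (simp add: differentiable_on_eq_differentiable_at)

text \<open>
  The choice made by \<open>frechet_derivative\<close> depends only on which maps are derivatives at \<open>x\<close>, and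
  these are the same, possibly none, for functions that agree near \<open>x\<close>.
\<close>
lemma wirtinger_cong_open:
  assumes "open U" "x \<in> U" "\<And>y. y \<in> U \<Longrightarrow> f y = g y"
  shows "wirtinger \<kappa> f x = wirtinger \<kappa> g x"
proof -
  have "(f has_derivative D) (at x) \<longleftrightarrow> (g has_derivative D) (at x)" for D
    using has_derivative_transform_within_open[of f D x UNIV U g]
      has_derivative_transform_within_open[of g D x UNIV U f] assms by auto
  then show ?thesis by (simp add: wirtinger_eq_form_coeff frechet_derivative_def)
qed

lemma wirtinger_uminus:
  assumes "f differentiable (at x)"
  shows "wirtinger \<kappa> (\<lambda>y. - f y) x = - wirtinger \<kappa> f x"
proof -
  obtain D where D: "(f has_derivative D) (at x)" using assms by (auto simp: differentiable_def)
  have "wirtinger \<kappa> (\<lambda>y. - f y) x = form_coeff \<kappa> (\<lambda>v. - D v)"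
    by (rule wirtinger_has_derivative[OF has_derivative_minus[OF D]])
  also have "\<dots> = - wirtinger \<kappa> f x"
    by (simp add: wirtinger_has_derivative[OF D] form_coeff_def field_simps)
  finally show ?thesis .
qed

lemma wirtinger_zero: "wirtinger \<kappa> (\<lambda>y. 0) x = 0"
  using wirtinger_has_derivative[OF has_derivative_const] by (simp add: form_coeff_zero)

text \<open>The product rule, in which the derivative never falls on \<open>a\<close>.\<close>
lemma wirtinger_dot:
  assumes a: "\<And>i. i \<in> {1..N} \<Longrightarrow> a i differentiable (at x)"
    and a0: "\<And>i. i \<in> {1..N} \<Longrightarrow> wirtinger \<kappa> (a i) x = 0"
    and b: "\<And>i. i \<in> {1..N} \<Longrightarrow> b i differentiable (at x)"
  shows "wirtinger \<kappa> (dot N a b) x = dot N a (\<lambda>i. wirtinger \<kappa> (b i)) x"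
proof -
  let ?A = "\<lambda>i. frechet_derivative (a i) (at x)" and ?B = "\<lambda>i. frechet_derivative (b i) (at x)"
  have "(dot N a b has_derivative (\<lambda>v. \<Sum>i=1..N. a i x * ?B i v + ?A i v * b i x)) (at x)"
    unfolding dot_def[abs_def] using a b
    by (intro has_derivative_sum has_derivative_mult) (simp_all add: frechet_derivative_works)
  then have "wirtinger \<kappa> (dot N a b) x
      = form_coeff \<kappa> (\<lambda>v. \<Sum>i=1..N. a i x * ?B i v + b i x * ?A i v)"
    by (simp add: wirtinger_has_derivative mult.commute)
  also have "\<dots> = (\<Sum>i=1..N. a i x * wirtinger \<kappa> (b i) x + b i x * wirtinger \<kappa> (a i) x)"
    by (simp add: form_coeff_sum form_coeff_add form_coeff_mult wirtinger_eq_form_coeff)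
  also have "\<dots> = dot N a (\<lambda>i. wirtinger \<kappa> (b i)) x"
    by (simp add: dot_def a0)
  finally show ?thesis .
qed

text \<open>
  The hypothesis concerns Wirtinger derivatives; the directional derivatives are their combinations
  with constant coefficients, by the expansion of \<open>dF\<close>.
\<close>
lemma directional_derivative_differentiable:
  fixes F :: "('m::{finite,linorder}, 'n::{finite,linorder}) point \<Rightarrow> complex"
  assumes F: "twice_R_differentiable_on F U" and U: "open U" "x \<in> U"
  shows "(\<lambda>y. frechet_derivative F (at y) v) differentiable (at x)"
proof -
  have diff: "wirtinger \<kappa> F differentiable (at x)" if "\<kappa> \<in> wvars CARD('m) CARD('n)" for \<kappa>
    using F U that differentiable_on_openD by (auto simp: twice_R_differentiable_on_def)
  let ?E = "\<lambda>y. (\<Sum>i=1..CARD('m). wirtinger (Z i) F y * differential (Z i) v)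
    + (\<Sum>i=1..CARD('m). wirtinger (Zbar i) F y * differential (Zbar i) v)
    + (\<Sum>\<xi>=1..CARD('n). wirtinger (W \<xi>) F y * differential (W \<xi>) v)
    + (\<Sum>\<xi>=1..CARD('n). wirtinger (Wbar \<xi>) F y * differential (Wbar \<xi>) v)"
  have E: "?E differentiable (at x)"
    by (intro differentiable_add differentiable_sum differentiable_mult differentiable_const
        ballI diff finite_atLeastAtMost)
      (auto simp: wvars_def)
  have eq: "?E y = frechet_derivative F (at y) v" if "y \<in> U" for y
  proof -
    have "F differentiable (at y)"
      using F U that differentiable_on_openD by (auto simp: twice_R_differentiable_on_def)
    then have "linear (frechet_derivative F (at y))" by (rule linear_frechet_derivative)
    from real_linear_form_expansion[OF this, of v] show ?thesis
      by (simp only: wirtinger_eq_form_coeff)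
  qed
  from E obtain D where "(?E has_derivative D) (at x)" by (auto simp only: differentiable_def)
  from has_derivative_transform_within_open[OF this U eq] show ?thesis
    unfolding differentiable_def by blast
qed

text \<open>
  Both sides are the same combination of four second directional derivatives, and each of these is
  symmetric.
\<close>
lemma wirtinger_commute:
  fixes F :: "('m::{finite,linorder}, 'n::{finite,linorder}) point \<Rightarrow> complex"
  assumes F: "twice_R_differentiable_on F U" and U: "open U" "x \<in> U"
  shows "wirtinger \<kappa> (wirtinger \<kappa>' F) x = wirtinger \<kappa>' (wirtinger \<kappa> F) x"
proof -
  let ?D = "\<lambda>y. frechet_derivative F (at y)"
  define H where "H u = frechet_derivative (\<lambda>y. ?D y u) (at x)" for u
  have H: "((\<lambda>y. ?D y u) has_derivative H u) (at x)" for u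
    unfolding H_def using directional_derivative_differentiable[OF F U]
    by (simp add: frechet_derivative_works)
  have sym: "H u v = H v u" for u v
  proof (rule second_derivative_symmetric[OF U _ H H])
    fix y assume "y \<in> U"
    then have "F differentiable (at y)"
      using F U differentiable_on_openD by (auto simp: twice_R_differentiable_on_def)
    then show "(F has_derivative ?D y) (at y)" by (simp add: frechet_derivative_works)
  qed
  let ?u = "\<lambda>\<kappa>. coord_direction \<kappa> 1" and ?v = "\<lambda>\<kappa>. coord_direction \<kappa> \<i>"
  have second: "wirtinger \<kappa> (wirtinger \<kappa>' F) x
      = form_coeff \<kappa> (\<lambda>w. (H (?u \<kappa>') w + wirtinger_unit \<kappa>' * H (?v \<kappa>') w) / 2)" for \<kappa> \<kappa>'
  proof (rule wirtinger_has_derivative)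
    have "wirtinger \<kappa>' F = (\<lambda>y. (?D y (?u \<kappa>') + wirtinger_unit \<kappa>' * ?D y (?v \<kappa>')) / 2)"
      by (simp add: fun_eq_iff wirtinger_eq_form_coeff form_coeff_def)
    then show "(wirtinger \<kappa>' F has_derivative
        (\<lambda>w. (H (?u \<kappa>') w + wirtinger_unit \<kappa>' * H (?v \<kappa>') w) / 2)) (at x)"
      by (auto intro!: derivative_eq_intros H)
  qed
  show ?thesis
    unfolding second form_coeff_def
    by (simp add: sym[of "?u \<kappa>" "?u \<kappa>'"] sym[of "?u \<kappa>" "?v \<kappa>'"]
        sym[of "?v \<kappa>" "?u \<kappa>'"] sym[of "?v \<kappa>" "?v \<kappa>'"] field_simps)
qed

text \<open>
  Differentiating \<open>\<partial>\<^sub>\<chi> F = 0\<close>, which holds on the whole open set, and commuting gives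
  \<open>\<partial>\<^sub>\<chi> \<partial>\<^sub>\<kappa> F = 0\<close>.
\<close>
lemma has_form_wirtinger:
  fixes F :: "('m::{finite,linorder}, 'n::{finite,linorder}) point \<Rightarrow> complex"
  assumes F: "twice_R_differentiable_on F U" and "open U" and "has_form V U F"
    and "\<kappa> \<in> wvars CARD('m) CARD('n)"
  shows "has_form V U (wirtinger \<kappa> F)"
  unfolding has_form_def
proof (intro conjI ballI)
  show "wirtinger \<kappa> F differentiable_on U"
    using assms by (auto simp: twice_R_differentiable_on_def)
  fix \<kappa>' x assume "\<kappa>' \<in> V" "x \<in> U"
  have "wirtinger \<kappa>' (wirtinger \<kappa> F) x = wirtinger \<kappa> (wirtinger \<kappa>' F) x"
    by (rule wirtinger_commute[OF F \<open>open U\<close> \<open>x \<in> U\<close>])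
  also have "\<dots> = wirtinger \<kappa> (\<lambda>y. 0) x"
    using assms(3) \<open>\<kappa>' \<in> V\<close>
    by (intro wirtinger_cong_open[OF \<open>open U\<close> \<open>x \<in> U\<close>]) (simp add: has_form_def)
  finally show "wirtinger \<kappa>' (wirtinger \<kappa> F) x = 0" by (simp add: wirtinger_zero)
qed

section \<open>Differential consequences\<close>

text \<open>
  The equation holds on an open set, so it may be differentiated with respect to \<open>\<kappa>\<close>.  This kills
  \<open>\<psi>\<close> and passes through \<open>\<phi>\<close>, leaving an equation between functions that can be differentiated
  again, as long as the coefficients \<open>b\<close> have derivatives.
\<close>
lemma dot_deriv_eq_zero:
  assumes U: "open U" and \<kappa>: "\<kappa> \<in> V"
    and \<phi>: "\<And>i. i \<in> {1..N} \<Longrightarrow> has_form V U (\<phi> i)" and \<psi>: "has_form V U \<psi>"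
    and eq: "\<And>x. x \<in> U \<Longrightarrow> \<psi> x + dot N \<phi> b x = 0"
    and b: "\<And>i q. i \<in> {1..N} \<Longrightarrow> q < P \<Longrightarrow> (wirtinger \<kappa> ^^ q) (b i) differentiable_on U"
    and "p \<in> {1..P}" "x \<in> U"
  shows "dot_deriv N \<phi> \<kappa> p b x = 0"
proof -
  have step: "dot_deriv N \<phi> \<kappa> (Suc q) b x = wirtinger \<kappa> (dot_deriv N \<phi> \<kappa> q b) x"
    if "q < P" "x \<in> U" for q x
  proof -
    have "\<phi> i differentiable (at x)" if "i \<in> {1..N}" for i
      using \<phi>[OF that] by (intro differentiable_on_openD[OF _ U \<open>x \<in> U\<close>]) (simp add: has_form_def)
    moreover have "wirtinger \<kappa> (\<phi> i) x = 0" if "i \<in> {1..N}" for i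
      using \<phi>[OF that] \<kappa> \<open>x \<in> U\<close> by (simp add: has_form_def)
    moreover have "(wirtinger \<kappa> ^^ q) (b i) differentiable (at x)" if "i \<in> {1..N}" for i
      by (rule differentiable_on_openD[OF b[OF that \<open>q < P\<close>] U \<open>x \<in> U\<close>])
    ultimately have "wirtinger \<kappa> (dot N \<phi> (\<lambda>i. (wirtinger \<kappa> ^^ q) (b i))) x
        = dot N \<phi> (\<lambda>i. wirtinger \<kappa> ((wirtinger \<kappa> ^^ q) (b i))) x"
      by (rule wirtinger_dot)
    then show ?thesis by (simp add: dot_deriv_def)
  qed
  have "dot_deriv N \<phi> \<kappa> (Suc q) b x = 0" if "q < P" "x \<in> U" for q x
    using that
  proof (induction q arbitrary: x)
    case 0
    have "wirtinger \<kappa> (dot_deriv N \<phi> \<kappa> 0 b) x = wirtinger \<kappa> (\<lambda>y. - \<psi> y) x"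
      using eq by (intro wirtinger_cong_open[OF U \<open>x \<in> U\<close>])
        (simp add: dot_deriv_def add_eq_0_iff)
    also have "\<dots> = 0"
      using \<psi> \<kappa> \<open>x \<in> U\<close> differentiable_on_openD[OF _ U \<open>x \<in> U\<close>, of \<psi>]
      by (simp add: has_form_def wirtinger_uminus)
    finally show ?case using 0 by (simp add: step)
  next
    case (Suc q)
    have "wirtinger \<kappa> (dot_deriv N \<phi> \<kappa> (Suc q) b) x = wirtinger \<kappa> (\<lambda>y. 0) x"
      using Suc by (intro wirtinger_cong_open[OF U \<open>x \<in> U\<close>]) simp
    then show ?case using Suc.prems by (simp add: step wirtinger_zero)
  qed
  from this[of "p - 1" x] show ?thesis using assms(7,8) by auto
qed

section \<open>The system and the Pfaffian form\<close>

lemma sum_permuted_initial_segment: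
  fixes f :: "nat \<Rightarrow> 'a::comm_monoid_add"
  assumes "\<pi> permutes {1..n}" "k \<le> n" "\<And>i. i \<in> {k+1..n} \<Longrightarrow> f (\<pi> i) = 0"
  shows "(\<Sum>i=1..n. f i) = (\<Sum>i=1..k. f (\<pi> i))"
proof -
  have "(\<Sum>i=1..n. f i) = (\<Sum>i=1..n. f (\<pi> i))"
    using sum.permute[OF assms(1), of f] by (simp add: o_def)
  also have "\<dots> = (\<Sum>i=1..k. f (\<pi> i))"
    using assms(2,3) by (intro sum.mono_neutral_right) auto
  finally show ?thesis .
qed

lemma dot_concat_vec:
  "dot (k1 + k2) (concat_vec k1 a b) (concat_vec k1 c d) x
    = (\<Sum>i=1..k1. a i x * c i x) + (\<Sum>i=1..k2. b i x * d i x)"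
proof -
  have "{1..k1 + k2} = {1..k1} \<union> {k1+1..k1 + k2}" by auto
  then have "dot (k1 + k2) (concat_vec k1 a b) (concat_vec k1 c d) x
      = (\<Sum>i=1..k1. a i x * c i x) + (\<Sum>i=k1+1..k1 + k2. b (i - k1) x * d (i - k1) x)"
    by (simp add: dot_def sum.union_disjoint concat_vec_def)
  also have "(\<Sum>i=k1+1..k1 + k2. b (i - k1) x * d (i - k1) x) = (\<Sum>i=1..k2. b i x * d i x)"
    by (rule sum.reindex_bij_witness[where i = "\<lambda>i. i + k1" and j = "\<lambda>i. i - k1"]) auto
  finally show ?thesis .
qed

text \<open>
  The factor \<open>c\<close> is the value at \<open>x\<close> of the integrating factor; it is \<open>1\<close> when \<open>\<phi>\<close> consists of the
  derivatives of \<open>F\<close>.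
\<close>
lemma op_X_eq_dot:
  fixes F :: "('m::{finite,linorder}, 'n::{finite,linorder}) point \<Rightarrow> complex"
  assumes "k1 \<le> CARD('n)" "k2 \<le> CARD('n)" and \<zeta>: "\<zeta> permutes {1..CARD('n)}"
    and w: "\<And>\<xi>. \<xi> \<in> {1..k1} \<Longrightarrow> wirtinger (W \<xi>) F x = c * \<phi>1 \<xi> x"
    and w0: "\<And>\<xi>. \<xi> \<in> {k1+1..CARD('n)} \<Longrightarrow> wirtinger (W \<xi>) F x = 0"
    and wbar: "\<And>\<tau>. \<tau> \<in> {1..k2} \<Longrightarrow> wirtinger (Wbar (\<zeta> \<tau>)) F x = c * \<phi>2 \<tau> x"
    and wbar0: "\<And>\<tau>. \<tau> \<in> {k2+1..CARD('n)} \<Longrightarrow> wirtinger (Wbar (\<zeta> \<tau>)) F x = 0"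
  shows "op_X X l F x = wirtinger (if l \<le> CARD('m) then Z l else Zbar (l - CARD('m))) F x
    + c * dot (k1 + k2) (concat_vec k1 \<phi>1 \<phi>2) (lambda_X k1 \<zeta> X l) x"
proof -
  have "(\<Sum>\<xi>=1..CARD('n). X \<xi> l x * wirtinger (W \<xi>) F x) = (\<Sum>\<xi>=1..k1. c * (\<phi>1 \<xi> x * X \<xi> l x))"
    using assms(1) w w0
    by (subst sum_permuted_initial_segment[OF permutes_id, of k1]) (simp_all add: mult_ac)
  moreover have "(\<Sum>\<xi>=1..CARD('n). cnj (X \<xi> (swap_index CARD('m) l) x) * wirtinger (Wbar \<xi>) F x)
      = (\<Sum>\<tau>=1..k2. c * (\<phi>2 \<tau> x * cnj (X (\<zeta> \<tau>) (swap_index CARD('m) l) x)))"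
    using assms(2) wbar wbar0
    by (subst sum_permuted_initial_segment[OF \<zeta>, of k2]) (simp_all add: mult_ac)
  ultimately show ?thesis
    by (simp add: op_X_def lambda_X_def dot_concat_vec sum.distrib sum_distrib_left distrib_left)
qed

lemma frechet_derivative_eq_pfaff_form:
  fixes F :: "('m::{finite,linorder}, 'n::{finite,linorder}) point \<Rightarrow> complex"
  assumes "s1 \<le> CARD('m)" "s2 \<le> CARD('m)" "k1 \<le> CARD('n)" "k2 \<le> CARD('n)"
    and j: "j permutes {1..CARD('m)}" and \<zeta>: "\<zeta> permutes {1..CARD('n)}"
    and diff: "F differentiable (at x)"
    and V: "\<And>\<kappa>. \<kappa> \<in> annihilated_vars CARD('m) CARD('n) s1 s2 k1 k2 j \<zeta> \<Longrightarrow> wirtinger \<kappa> F x = 0"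
  shows "frechet_derivative F (at x) v =
    pfaff_form s1 s2 k1 k2 j \<zeta> (\<lambda>\<theta>. wirtinger (Z \<theta>) F) (\<lambda>g. wirtinger (Zbar (j g)) F)
      (\<lambda>\<xi>. wirtinger (W \<xi>) F) (\<lambda>\<tau>. wirtinger (Wbar (\<zeta> \<tau>)) F) x v"
proof -
  have z: "wirtinger (Z \<theta>) F x = 0" if "\<theta> \<in> {s1+1..CARD('m)}" for \<theta>
    using that by (intro V) (simp add: annihilated_vars_def)
  have zbar: "wirtinger (Zbar (j g)) F x = 0" if "g \<in> {s2+1..CARD('m)}" for g
    using that by (intro V) (simp add: annihilated_vars_def)
  have w: "wirtinger (W \<xi>) F x = 0" if "\<xi> \<in> {k1+1..CARD('n)}" for \<xi>
    using that by (intro V) (simp add: annihilated_vars_def)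
  have wbar: "wirtinger (Wbar (\<zeta> \<tau>)) F x = 0" if "\<tau> \<in> {k2+1..CARD('n)}" for \<tau>
    using that by (intro V) (simp add: annihilated_vars_def)
  note expand = real_linear_form_expansion[OF linear_frechet_derivative[OF diff], of v,
      folded wirtinger_eq_form_coeff]
  show ?thesis
    unfolding expand pfaff_form_def using assms(1-4) z zbar w wbar
    by (intro arg_cong2[where f = "(+)"]
        sum_permuted_initial_segment[OF permutes_id, unfolded id_apply]
        sum_permuted_initial_segment[OF j] sum_permuted_initial_segment[OF \<zeta>]) simp_all
qed

text \<open>
  Since the Pfaffian form lacks the differentials of the variables in \<open>V\<close>, the coefficients there are
  zero.  Conjugate variables are indexed through \<open>j\<close> and \<open>\<zeta>\<close>, which reaches all of them because
  these are permutations.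
\<close>
lemma form_coeff_pfaff_form:
  fixes \<psi>1 \<psi>2 \<phi>1 \<phi>2 :: "nat \<Rightarrow> ('m::{finite,linorder}, 'n::{finite,linorder}) point \<Rightarrow> complex"
    and x :: "('m, 'n) point"
  assumes s: "s1 \<le> CARD('m)" "s2 \<le> CARD('m)" "k1 \<le> CARD('n)" "k2 \<le> CARD('n)"
    and j: "j permutes {1..CARD('m)}" and \<zeta>: "\<zeta> permutes {1..CARD('n)}"
  defines "\<omega> \<equiv> pfaff_form s1 s2 k1 k2 j \<zeta> \<psi>1 \<psi>2 \<phi>1 \<phi>2 x"
  shows "\<theta> \<in> {1..CARD('m)} \<Longrightarrow> form_coeff (Z \<theta>) \<omega> = (if \<theta> \<le> s1 then \<psi>1 \<theta> x else 0)"
    and "g \<in> {1..CARD('m)} \<Longrightarrow> form_coeff (Zbar (j g)) \<omega> = (if g \<le> s2 then \<psi>2 g x else 0)"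
    and "\<xi> \<in> {1..CARD('n)} \<Longrightarrow> form_coeff (W \<xi>) \<omega> = (if \<xi> \<le> k1 then \<phi>1 \<xi> x else 0)"
    and "\<tau> \<in> {1..CARD('n)} \<Longrightarrow> form_coeff (Wbar (\<zeta> \<tau>)) \<omega> = (if \<tau> \<le> k2 then \<phi>2 \<tau> x else 0)"
proof -
  have j_in: "j g \<in> {1..CARD('m)}" if "g \<in> {1..CARD('m)}" for g
    using permutes_in_image[OF j] that by blast
  have \<zeta>_in: "\<zeta> g \<in> {1..CARD('n)}" if "g \<in> {1..CARD('n)}" for g
    using permutes_in_image[OF \<zeta>] that by blast
  have wv: "\<And>i. i \<in> {1..CARD('m)} \<Longrightarrow> Z i \<in> wvars CARD('m) CARD('n)"
    "\<And>i. i \<in> {1..CARD('m)} \<Longrightarrow> Zbar (j i) \<in> wvars CARD('m) CARD('n)"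
    "\<And>i. i \<in> {1..CARD('n)} \<Longrightarrow> W i \<in> wvars CARD('m) CARD('n)"
    "\<And>i. i \<in> {1..CARD('n)} \<Longrightarrow> Wbar (\<zeta> i) \<in> wvars CARD('m) CARD('n)"
    using j_in \<zeta>_in by (simp_all add: wvars_def)
  have coeff: "form_coeff \<kappa> \<omega> =
      (\<Sum>\<theta>=1..s1. \<psi>1 \<theta> x * of_bool (\<kappa> = Z \<theta>))
      + (\<Sum>g=1..s2. \<psi>2 g x * of_bool (\<kappa> = Zbar (j g)))
      + (\<Sum>\<xi>=1..k1. \<phi>1 \<xi> x * of_bool (\<kappa> = W \<xi>))
      + (\<Sum>\<tau>=1..k2. \<phi>2 \<tau> x * of_bool (\<kappa> = Wbar (\<zeta> \<tau>)))"
    if \<kappa>: "\<kappa> \<in> wvars CARD('m) CARD('n)" for \<kappa>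
    unfolding \<omega>_def pfaff_form_def form_coeff_add form_coeff_sum form_coeff_mult
    using s by (intro arg_cong2[where f = "(+)"] sum.cong refl)
      (subst form_coeff_differential[OF \<kappa> wv(1)] form_coeff_differential[OF \<kappa> wv(2)]
        form_coeff_differential[OF \<kappa> wv(3)] form_coeff_differential[OF \<kappa> wv(4)]; simp)+
  have inj: "j a = j b \<longleftrightarrow> a = b" "\<zeta> a = \<zeta> b \<longleftrightarrow> a = b" for a b
    using permutes_inj[OF j] permutes_inj[OF \<zeta>] by (auto dest: injD)
  show "form_coeff (Z \<theta>) \<omega> = (if \<theta> \<le> s1 then \<psi>1 \<theta> x else 0)" if "\<theta> \<in> {1..CARD('m)}"
    using that by (subst coeff[OF wv(1)]) (auto simp: of_bool_def if_distrib cong: if_cong)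
  show "form_coeff (Zbar (j g)) \<omega> = (if g \<le> s2 then \<psi>2 g x else 0)" if "g \<in> {1..CARD('m)}"
    using that by (subst coeff[OF wv(2)]) (auto simp: inj of_bool_def if_distrib cong: if_cong)
  show "form_coeff (W \<xi>) \<omega> = (if \<xi> \<le> k1 then \<phi>1 \<xi> x else 0)" if "\<xi> \<in> {1..CARD('n)}"
    using that by (subst coeff[OF wv(3)]) (auto simp: of_bool_def if_distrib cong: if_cong)
  show "form_coeff (Wbar (\<zeta> \<tau>)) \<omega> = (if \<tau> \<le> k2 then \<phi>2 \<tau> x else 0)" if "\<tau> \<in> {1..CARD('n)}"
    using that by (subst coeff[OF wv(4)]) (auto simp: inj of_bool_def if_distrib cong: if_cong)
qed


section \<open>The two implications\<close>

text \<open>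
  Where an equation of the functional system has no \<open>\<psi>\<close>-term, the corresponding derivative of \<open>F\<close>
  is zero because its variable belongs to \<open>V\<close>.  So all four groups of equations are
  instances of one equation, differentiated as often as the assumed derivatives allow.
\<close>
lemma generated_by_E0_if_first_integral:
  fixes F :: "('m::{finite,linorder}, 'n::{finite,linorder}) point \<Rightarrow> complex"
    and V :: "wvar set"
  assumes U: "open U"
    and s: "s1 \<le> CARD('m)" "s2 \<le> CARD('m)" "k1 \<le> CARD('n)" "k2 \<le> CARD('n)"
    and j: "j permutes {1..CARD('m)}" and \<zeta>: "\<zeta> permutes {1..CARD('n)}"
    and V: "V = annihilated_vars CARD('m) CARD('n) s1 s2 k1 k2 j \<zeta>"
    and X: "coeff_derivs_exist V s1 s2 k1 k2 j \<zeta> U X"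
    and F2: "twice_R_differentiable_on F U" and form: "has_form V U F" and int: "first_integral X U F"
  shows "generated_by_E0 V s1 s2 k1 k2 j \<zeta> U X F"
proof -
  define \<psi>1 \<psi>2 \<phi>1 \<phi>2 where "\<psi>1 = (\<lambda>\<theta>. wirtinger (Z \<theta>) F)"
    and "\<psi>2 = (\<lambda>g. wirtinger (Zbar (j g)) F)"
    and "\<phi>1 = (\<lambda>\<xi>. wirtinger (W \<xi>) F)"
    and "\<phi>2 = (\<lambda>\<tau>. wirtinger (Wbar (\<zeta> \<tau>)) F)"
  note defs = \<psi>1_def \<psi>2_def \<phi>1_def \<phi>2_def
  let ?\<phi> = "concat_vec k1 \<phi>1 \<phi>2" and ?X = "lambda_X k1 \<zeta> X"
  have j_in: "j g \<in> {1..CARD('m)}" if "g \<in> {1..CARD('m)}" for g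
    using permutes_in_image[OF j] that by blast
  have \<zeta>_in: "\<zeta> \<tau> \<in> {1..CARD('n)}" if "\<tau> \<in> {1..CARD('n)}" for \<tau>
    using permutes_in_image[OF \<zeta>] that by blast
  have form_\<psi>1: "has_form V U (\<psi>1 \<theta>)" if "\<theta> \<in> {1..CARD('m)}" for \<theta>
    unfolding \<psi>1_def using that
    by (intro has_form_wirtinger[OF F2 U form]) (simp add: wvars_def)
  have form_\<psi>2: "has_form V U (\<psi>2 g)" if "g \<in> {1..CARD('m)}" for g
    unfolding \<psi>2_def using j_in[OF that]
    by (intro has_form_wirtinger[OF F2 U form]) (simp add: wvars_def)
  have form_\<phi>1: "has_form V U (\<phi>1 \<xi>)" if "\<xi> \<in> {1..CARD('n)}" for \<xi>
    unfolding \<phi>1_def using that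
    by (intro has_form_wirtinger[OF F2 U form]) (simp add: wvars_def)
  have form_\<phi>2: "has_form V U (\<phi>2 \<tau>)" if "\<tau> \<in> {1..CARD('n)}" for \<tau>
    unfolding \<phi>2_def using \<zeta>_in[OF that]
    by (intro has_form_wirtinger[OF F2 U form]) (simp add: wvars_def)
  have form_\<phi>: "has_form V U (?\<phi> i)" if "i \<in> {1..k1 + k2}" for i
  proof (cases "i \<le> k1")
    case True
    then show ?thesis using that s form_\<phi>1[of i] by (simp add: concat_vec_def)
  next
    case False
    then have "i - k1 \<in> {1..CARD('n)}" using that s by auto
    then show ?thesis using False form_\<phi>2 by (simp add: concat_vec_def)
  qed
  have vanish: "wirtinger \<kappa> F x = 0" if "\<kappa> \<in> V" "x \<in> U" for \<kappa> x
    using form that by (simp add: has_form_def)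
  have op: "wirtinger (if l \<le> CARD('m) then Z l else Zbar (l - CARD('m))) F x
      + dot (k1 + k2) ?\<phi> (?X l) x = 0" if "l \<in> {1..2 * CARD('m)}" "x \<in> U" for l x
  proof -
    have "op_X X l F x = 0" using int that by (simp add: first_integral_def)
    moreover have "op_X X l F x = wirtinger (if l \<le> CARD('m) then Z l else Zbar (l - CARD('m))) F x
        + 1 * dot (k1 + k2) ?\<phi> (?X l) x"
      by (rule op_X_eq_dot[OF s(3,4) \<zeta>])
        (simp_all add: defs vanish[OF _ \<open>x \<in> U\<close>] V annihilated_vars_def del: wirtinger.simps)
    ultimately show ?thesis by simp
  qed
  have op_z: "\<psi>1 \<theta> x + dot (k1 + k2) ?\<phi> (?X \<theta>) x = 0"
    if "\<theta> \<in> {1..CARD('m)}" "x \<in> U" for \<theta> x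
    using op[of \<theta> x] that by (simp add: \<psi>1_def)
  have op_zbar: "\<psi>2 g x + dot (k1 + k2) ?\<phi> (?X (CARD('m) + j g)) x = 0"
    if "g \<in> {1..CARD('m)}" "x \<in> U" for g x
    using op[of "CARD('m) + j g" x] j_in[OF that(1)] that(2) by (simp add: \<psi>2_def split: if_splits)
  have \<psi>1_0: "\<psi>1 \<eta> x = 0" if "\<eta> \<in> {s1+1..CARD('m)}" "x \<in> U" for \<eta> x
    using vanish[of "Z \<eta>" x] that by (simp add: \<psi>1_def V annihilated_vars_def)
  have \<psi>2_0: "\<psi>2 \<nu> x = 0" if "\<nu> \<in> {s2+1..CARD('m)}" "x \<in> U" for \<nu> x
    using vanish[of "Zbar (j \<nu>)" x] that by (simp add: \<psi>2_def V annihilated_vars_def)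
  have deriv_long: "(wirtinger \<kappa> ^^ q) (?X l i) differentiable_on U"
    if "\<kappa> \<in> V" "i \<in> {1..k1 + k2}" "q < k1 + k2"
      "l \<in> {1..s1} \<union> (\<lambda>g. CARD('m) + j g) ` {1..s2}" for \<kappa> i q l
    using X that unfolding coeff_derivs_exist_def by blast
  have deriv_short: "(wirtinger \<kappa> ^^ q) (?X l i) differentiable_on U"
    if "\<kappa> \<in> V" "i \<in> {1..k1 + k2}" "q < k1 + k2 - 1"
      "l \<in> {s1+1..CARD('m)} \<union> (\<lambda>\<nu>. CARD('m) + j \<nu>) ` {s2+1..CARD('m)}" for \<kappa> i q l
    using X that unfolding coeff_derivs_exist_def by blast
  note consequence = dot_deriv_eq_zero[OF U, where N = "k1 + k2" and \<phi> = ?\<phi>, OF _ form_\<phi>]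
  have "system_E0 V s1 s2 k1 k2 j \<zeta> U X \<psi>1 \<psi>2 \<phi>1 \<phi>2"
    unfolding system_E0_def
  proof (intro ballI conjI)
    fix x assume x: "x \<in> U"
    {
      fix \<theta> assume \<theta>: "\<theta> \<in> {1..s1}"
      then have \<theta>': "\<theta> \<in> {1..CARD('m)}" using s by auto
      show "\<psi>1 \<theta> x + dot (k1 + k2) ?\<phi> (?X \<theta>) x = 0" by (rule op_z[OF \<theta>' x])
      fix \<kappa> p assume "\<kappa> \<in> V" "p \<in> {1..k1 + k2}"
      then show "dot_deriv (k1 + k2) ?\<phi> \<kappa> p (?X \<theta>) x = 0"
        using \<theta> x by (intro consequence[OF _ _ form_\<psi>1[OF \<theta>'] op_z[OF \<theta>'], where P = "k1 + k2"] deriv_long) auto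
    next
      fix \<eta> assume \<eta>: "\<eta> \<in> {s1+1..CARD('m)}"
      then have \<eta>': "\<eta> \<in> {1..CARD('m)}" by auto
      show "dot (k1 + k2) ?\<phi> (?X \<eta>) x = 0" using op_z[OF \<eta>' x] \<psi>1_0[OF \<eta> x] by simp
      fix \<kappa> p assume "\<kappa> \<in> V" "p \<in> {1..k1 + k2 - 1}"
      then show "dot_deriv (k1 + k2) ?\<phi> \<kappa> p (?X \<eta>) x = 0"
        using \<eta> x by (intro consequence[OF _ _ form_\<psi>1[OF \<eta>'] op_z[OF \<eta>'], where P = "k1 + k2 - 1"] deriv_short) auto
    next
      fix g assume g: "g \<in> {1..s2}"
      then have g': "g \<in> {1..CARD('m)}" using s by auto
      show "\<psi>2 g x + dot (k1 + k2) ?\<phi> (?X (CARD('m) + j g)) x = 0" by (rule op_zbar[OF g' x])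
      fix \<kappa> p assume "\<kappa> \<in> V" "p \<in> {1..k1 + k2}"
      then show "dot_deriv (k1 + k2) ?\<phi> \<kappa> p (?X (CARD('m) + j g)) x = 0"
        using g x by (intro consequence[OF _ _ form_\<psi>2[OF g'] op_zbar[OF g'], where P = "k1 + k2"] deriv_long) auto
    next
      fix \<nu> assume \<nu>: "\<nu> \<in> {s2+1..CARD('m)}"
      then have \<nu>': "\<nu> \<in> {1..CARD('m)}" by auto
      show "dot (k1 + k2) ?\<phi> (?X (CARD('m) + j \<nu>)) x = 0"
        using op_zbar[OF \<nu>' x] \<psi>2_0[OF \<nu> x] by simp
      fix \<kappa> p assume "\<kappa> \<in> V" "p \<in> {1..k1 + k2 - 1}"
      then show "dot_deriv (k1 + k2) ?\<phi> \<kappa> p (?X (CARD('m) + j \<nu>)) x = 0"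
        using \<nu> x by (intro consequence[OF _ _ form_\<psi>2[OF \<nu>'] op_zbar[OF \<nu>'], where P = "k1 + k2 - 1"] deriv_short) auto
    }
  qed
  moreover have "general_integral V U (pfaff_form s1 s2 k1 k2 j \<zeta> \<psi>1 \<psi>2 \<phi>1 \<phi>2) F"
    unfolding general_integral_def
  proof (intro conjI exI[of _ "\<lambda>x. 1"] ballI)
    show "has_form V U F" by (rule form)
    show "\<not> F constant_on U" using int by (simp add: first_integral_def)
    show "has_form V U (\<lambda>x. 1)"
      by (simp add: has_form_def wirtinger_has_derivative[OF has_derivative_const] form_coeff_zero)
    show "(1::complex) \<noteq> 0" by simp
    fix x assume "x \<in> U"
    then have diff: "F differentiable (at x)"
      using form U by (auto simp: has_form_def intro: differentiable_on_openD)
    have "frechet_derivative F (at x) = pfaff_form s1 s2 k1 k2 j \<zeta> \<psi>1 \<psi>2 \<phi>1 \<phi>2 x"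
      unfolding defs using vanish \<open>x \<in> U\<close> V
      by (intro ext frechet_derivative_eq_pfaff_form[OF s j \<zeta> diff]) simp
    with diff show "(F has_derivative (\<lambda>v. 1 * pfaff_form s1 s2 k1 k2 j \<zeta> \<psi>1 \<psi>2 \<phi>1 \<phi>2 x v)) (at x)"
      by (simp add: frechet_derivative_works)
  qed
  ultimately show ?thesis
    unfolding generated_by_E0_def using s form_\<psi>1 form_\<psi>2 form_\<phi>1 form_\<phi>2
    by (intro exI[of _ \<psi>1] exI[of _ \<psi>2] exI[of _ \<phi>1] exI[of _ \<phi>2]) simp
qed

text \<open>
  Comparing coefficients in \<open>dF = \<mu> \<omega>\<close> gives \<open>op_X X l F = \<mu> (\<psi> + \<phi> \<cdot> X)\<close>, with \<open>\<psi>\<close> read as zero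
  in the equations for variables in \<open>V\<close>.
\<close>
lemma first_integral_if_generated_by_E0:
  fixes F :: "('m::{finite,linorder}, 'n::{finite,linorder}) point \<Rightarrow> complex"
    and V :: "wvar set"
  assumes s: "s1 \<le> CARD('m)" "s2 \<le> CARD('m)" "k1 \<le> CARD('n)" "k2 \<le> CARD('n)"
    and j: "j permutes {1..CARD('m)}" and \<zeta>: "\<zeta> permutes {1..CARD('n)}"
    and gen: "generated_by_E0 V s1 s2 k1 k2 j \<zeta> U X F"
  shows "has_form V U F \<and> first_integral X U F"
proof -
  from gen obtain \<psi>1 \<psi>2 \<phi>1 \<phi>2 \<mu>
    where E0: "system_E0 V s1 s2 k1 k2 j \<zeta> U X \<psi>1 \<psi>2 \<phi>1 \<phi>2"
      and form: "has_form V U F" and nonconst: "\<not> F constant_on U"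
      and dF: "\<And>x. x \<in> U \<Longrightarrow>
        (F has_derivative (\<lambda>v. \<mu> x * pfaff_form s1 s2 k1 k2 j \<zeta> \<psi>1 \<psi>2 \<phi>1 \<phi>2 x v)) (at x)"
    unfolding generated_by_E0_def general_integral_def by blast
  have "op_X X l F x = 0" if l: "l \<in> {1..2 * CARD('m)}" and x: "x \<in> U" for l x
  proof -
    let ?dot = "\<lambda>l. dot (k1 + k2) (concat_vec k1 \<phi>1 \<phi>2) (lambda_X k1 \<zeta> X l) x"
    have coeff: "wirtinger \<kappa> F x = \<mu> x * form_coeff \<kappa> (pfaff_form s1 s2 k1 k2 j \<zeta> \<psi>1 \<psi>2 \<phi>1 \<phi>2 x)"
      for \<kappa> by (simp add: wirtinger_has_derivative[OF dF[OF x]] form_coeff_mult)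
    note pfaff = form_coeff_pfaff_form[OF s j \<zeta>]
    have op: "op_X X l F x = wirtinger (if l \<le> CARD('m) then Z l else Zbar (l - CARD('m))) F x
        + \<mu> x * ?dot l"
      using s by (intro op_X_eq_dot[OF s(3,4) \<zeta>]) (simp_all add: coeff pfaff)
    show ?thesis
    proof (cases "l \<le> CARD('m)")
      case True
      then have "op_X X l F x = \<mu> x * ((if l \<le> s1 then \<psi>1 l x else 0) + ?dot l)"
        using l by (simp add: op coeff pfaff distrib_left)
      also have "(if l \<le> s1 then \<psi>1 l x else 0) + ?dot l = 0"
        using E0 x l True by (simp add: system_E0_def)
      finally show ?thesis by simp
    next
      case False
      (* The conjugate operators are listed by the system in the order given by j. *)
      then have "l - CARD('m) \<in> j ` {1..CARD('m)}"
        unfolding permutes_image[OF j] using l by auto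
      then obtain g where g: "g \<in> {1..CARD('m)}" "l - CARD('m) = j g" by blast
      then have lg: "l = CARD('m) + j g" using False by simp
      have "op_X X l F x = \<mu> x * ((if g \<le> s2 then \<psi>2 g x else 0) + ?dot l)"
        using False g by (simp add: op coeff pfaff distrib_left)
      also have "(if g \<le> s2 then \<psi>2 g x else 0) + ?dot l = 0"
        using E0 x g(1) by (simp add: lg system_E0_def)
      finally show ?thesis by simp
    qed
  qed
  then show ?thesis
    using form nonconst by (simp add: first_integral_def has_form_def)
qed

theorem theorem1p7:
  fixes G G' :: "('m::{finite,linorder}, 'n::{finite,linorder}) point set"
    and X :: "('m, 'n) coeffs"
    and s1 s2 k1 k2 :: nat
    and j \<zeta> :: "nat \<Rightarrow> nat"
    and V :: "wvar set"
  assumes "domain_in G" and "domain_in G'" and "G' \<subseteq> G"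
    and "\<And>\<xi> l. \<xi> \<in> {1..CARD('n)} \<Longrightarrow> l \<in> {1..2 * CARD('m)} \<Longrightarrow> X \<xi> l differentiable_on G"
    and "s1 \<le> CARD('m)" and "s2 \<le> CARD('m)" and "k1 \<le> CARD('n)" and "k2 \<le> CARD('n)"
    and "j permutes {1..CARD('m)}" and "\<zeta> permutes {1..CARD('n)}"
    and "V = annihilated_vars CARD('m) CARD('n) s1 s2 k1 k2 j \<zeta>"
    and "coeff_derivs_exist V s1 s2 k1 k2 j \<zeta> G' X"
  shows "((\<exists>F. twice_R_differentiable_on F G' \<and> has_form V G' F \<and> first_integral X G' F)
            \<longleftrightarrow> (\<exists>F. twice_R_differentiable_on F G' \<and> generated_by_E0 V s1 s2 k1 k2 j \<zeta> G' X F))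
       \<and> (\<forall>F. twice_R_differentiable_on F G' \<longrightarrow>
            (has_form V G' F \<and> first_integral X G' F
               \<longleftrightarrow> generated_by_E0 V s1 s2 k1 k2 j \<zeta> G' X F))"
proof -
  have "open G'" using assms(2) by (simp add: domain_in_def)
  have "has_form V G' F \<and> first_integral X G' F \<longleftrightarrow> generated_by_E0 V s1 s2 k1 k2 j \<zeta> G' X F"
    if "twice_R_differentiable_on F G'" for F
    using generated_by_E0_if_first_integral[OF \<open>open G'\<close> assms(5-12) that]
      first_integral_if_generated_by_E0[OF assms(5-10)] by blast
  then show ?thesis by blast
qed

end
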